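(* Let $n\geq 1$, $G=\mathbb{F}_2^n$, let $A\subset G$ have density $\alpha=|A|/|G|>0$, and let $c\in(0,1/2]$. Then there is a set $A'\subset G$ such that $A'+A'\subset D_c(A)$ and \[ |A'|\geq \left\lfloor \frac{\alpha^3\, 2^{\,n\left(1-\log \alpha^{-1}/\log c^{-1}\right)}}{12}\right\rfloor. \]
   Context: $\mathbb{P}_G$ denotes the normalized counting measure on $G$. For $f,g:G\to\mathbb{R}$, the convolution is $f\ast g(x)=\frac{1}{|G|}\sum_{y\in G}f(y)g(x-y)$. For $A\subset G$ of density $\alpha$ and $c\in[0,1]$, the popular difference set is $D_c(A)=\{x\in G: 1_A\ast 1_A(x)>c\alpha^2\}$. For sets $X,Y$, $X+Y=\{x+y:x\in X,y\in Y\}$. The ratio $\log\alpha^{-1}/\log c^{-1}$ is independent of the base of the logarithm. *)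

theory Defs
  imports "HOL-Analysis.Analysis" "HOL-Library.Z2" "HOL-Library.Set_Algebras"
begin

instance bit :: finite
proof
  have "(UNIV :: bit set) \<subseteq> {0, 1}"
    by (auto intro: bit.exhaust)
  then show "finite (UNIV :: bit set)"
    by (rule finite_subset) simp
qed

definition set_density :: "'a::finite set \<Rightarrow> real" where
  "set_density A = real (card A) / real CARD('a)"

definition normalized_convolution ::
    "('a::{ab_group_add,finite} \<Rightarrow> real) \<Rightarrow> ('a \<Rightarrow> real) \<Rightarrow> 'a \<Rightarrow> real" where
  "normalized_convolution f g x = 1 / real CARD('a) * (\<Sum>y\<in>UNIV. f y * g (x - y))"

text \<open>The convolution of \<open>1\<^sub>A\<close> with itself counts the ways to write \<open>x\<close> as a sum of two
  elements of \<open>A\<close>; the name refers to differences because the two notions agree in groups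
  of exponent 2, such as the powers of \<^typ>\<open>bit\<close>.\<close>

definition popular_diff :: "real \<Rightarrow> 'a::{ab_group_add,finite} set \<Rightarrow> 'a set" where
  "popular_diff c A =
     {x. normalized_convolution (indicat_real A) (indicat_real A) x > c * (set_density A)\<^sup>2}"

end

theory Submission
  imports Defs
begin

text \<open>Dependent random choice, derandomised: starting from the whole group, intersect repeatedly
  with well-chosen translates of \<open>A\<close>. Averaged over all translates, one step scales \<open>|X|\<close> by
  \<open>\<alpha>\<close>, but scales the number of pairs in \<open>X\<close> with unpopular sum by at most \<open>c \<alpha>\<^sup>2\<close>.
  After about \<open>log |G| / log (1 / (c \<alpha>))\<close> steps at most half of the elements lie
  in an unpopular pair, and deleting those elements gives \<open>A'\<close>. The exponent obtained
  dominates the claimed one because \<open>log (1 / (c \<alpha>)) \<ge> log (1 / c)\<close>.\<close>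

definition unpopular_pairs :: "real \<Rightarrow> 'a::{ab_group_add,finite} set \<Rightarrow> 'a set \<Rightarrow> ('a \<times> 'a) set"
  where "unpopular_pairs c A X = {(a, b) \<in> X \<times> X. a + b \<notin> popular_diff c A}"

lemma set_density_le_1: "set_density A \<le> 1"
  by (simp add: set_density_def card_mono)

lemma sum_indicat_shift:
  fixes A :: "'a::{ab_group_add,finite} set"
  shows "(\<Sum>t\<in>UNIV. indicat_real A (x + t)) = real CARD('a) * set_density A"
proof -
  have "(\<Sum>t\<in>UNIV. indicat_real A (x + t)) = (\<Sum>s\<in>UNIV. indicat_real A s)"
    by (rule sum.reindex_bij_witness[of _ "\<lambda>s. s - x" "\<lambda>t. x + t"]) auto
  then show ?thesis
    by (simp add: set_density_def indicator_def sum.If_cases)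
qed

text \<open>In exponent 2 the shift cancels, \<open>(a + t) + (b + t) = a + b\<close>. So as
  \<open>t\<close> varies, \<open>a + t\<close> and \<open>b + t\<close> run through all ways of
  writing \<open>a + b\<close> as a sum of two elements.\<close>

lemma sum_indicat_shift_pair:
  fixes A :: "'a::{ab_group_add,finite} set"
  assumes two: "\<And>x::'a. x + x = 0"
  shows "(\<Sum>t\<in>UNIV. indicat_real A (a + t) * indicat_real A (b + t)) =
    real CARD('a) * normalized_convolution (indicat_real A) (indicat_real A) (a + b)"
proof -
  have "- x = x" for x :: 'a
    using two[of x] by (simp add: minus_unique)
  then have minus: "x - y = x + y" for x y :: 'a
    by (metis diff_conv_add_uminus)
  have "(\<Sum>t\<in>UNIV. indicat_real A (a + t) * indicat_real A (b + t)) =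
      (\<Sum>y\<in>UNIV. indicat_real A y * indicat_real A (a + b - y))"
  proof (rule sum.reindex_bij_witness[of _ "\<lambda>s. s - a" "\<lambda>t. a + t"])
    fix t :: 'a
    have "a + b - (a + t) = b + t"
      using minus[of b t] by (simp only: add_diff_cancel_left)
    then show "indicat_real A (a + t) * indicat_real A (a + b - (a + t)) =
        indicat_real A (a + t) * indicat_real A (b + t)"
      by (simp only:)
  qed auto
  then show ?thesis
    by (simp add: normalized_convolution_def)
qed

text \<open>First moment argument over \<open>t\<close> for \<open>X\<close> intersected with the
  translate \<open>A - t\<close>. Size and bad pairs are combined into one linear functional with
  weight \<open>w\<close>, so that a single \<open>t\<close> controls both.\<close>

lemma exists_translate:
  fixes A X :: "'a::{ab_group_add,finite} set"
  assumes two: "\<And>x::'a. x + x = 0" and "w \<ge> 0"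
  obtains Y where
    "set_density A * (real (card X) - w * (c * set_density A) * real (card (unpopular_pairs c A X)))
      \<le> real (card Y) - w * real (card (unpopular_pairs c A Y))"
proof -
  define Y where "Y t = {x \<in> X. x + t \<in> A}" for t
  define \<alpha> where "\<alpha> = set_density A"
  define N where "N = real CARD('a)"
  let ?U = "unpopular_pairs c A"
  have "(\<Sum>t\<in>UNIV. real (card (Y t))) = (\<Sum>t\<in>UNIV. \<Sum>x\<in>X. indicat_real A (x + t))"
    by (simp add: Y_def indicator_def sum.If_cases Int_def)
  also have "\<dots> = N * (\<alpha> * real (card X))"
    by (subst sum.swap) (simp add: sum_indicat_shift N_def \<alpha>_def)
  finally have size: "(\<Sum>t\<in>UNIV. real (card (Y t))) = N * (\<alpha> * real (card X))" .
  have "real (card (?U (Y t))) =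
      (\<Sum>(a, b)\<in>?U X. indicat_real A (a + t) * indicat_real A (b + t))" for t
  proof -
    have "?U (Y t) = {p \<in> ?U X. fst p + t \<in> A \<and> snd p + t \<in> A}"
      by (auto simp: unpopular_pairs_def Y_def)
    then show ?thesis
      by (simp add: indicator_def case_prod_unfold sum.If_cases Int_def
          flip: of_bool_conj)
  qed
  then have "(\<Sum>t\<in>UNIV. real (card (?U (Y t)))) =
      (\<Sum>t\<in>UNIV. \<Sum>(a, b)\<in>?U X. indicat_real A (a + t) * indicat_real A (b + t))"
    by simp
  also have "\<dots> = (\<Sum>(a, b)\<in>?U X. \<Sum>t\<in>UNIV. indicat_real A (a + t) * indicat_real A (b + t))"
    by (subst sum.swap) (simp add: case_prod_unfold)
  \<comment> \<open>A pair survives the shift \<open>t\<close> when both entries land in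
    \<open>A\<close>; unpopularity of its sum bounds the proportion of such \<open>t\<close> by
    \<open>c * \<alpha>\<^sup>2\<close>.\<close>
  also have "\<dots> \<le> (\<Sum>p\<in>?U X. N * (c * \<alpha>\<^sup>2))"
  proof (rule sum_mono, clarify)
    fix a b assume "(a, b) \<in> ?U X"
    then show "(\<Sum>t\<in>UNIV. indicat_real A (a + t) * indicat_real A (b + t)) \<le> N * (c * \<alpha>\<^sup>2)"
      unfolding sum_indicat_shift_pair[OF two] N_def \<alpha>_def
      by (intro mult_left_mono) (auto simp: unpopular_pairs_def popular_diff_def)
  qed
  finally have pairs: "(\<Sum>t\<in>UNIV. real (card (?U (Y t)))) \<le> N * (c * \<alpha>\<^sup>2 * real (card (?U X)))"
    by (simp add: algebra_simps)
  let ?v = "\<alpha> * (real (card X) - w * (c * \<alpha>) * real (card (?U X)))"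
  let ?f = "\<lambda>t. real (card (Y t)) - w * real (card (?U (Y t)))"
  have "(\<Sum>t\<in>(UNIV :: 'a set). ?v) = N * (\<alpha> * real (card X)) - w * (N * (c * \<alpha>\<^sup>2 * real (card (?U X))))"
    by (simp add: N_def power2_eq_square algebra_simps)
  also have "\<dots> \<le> N * (\<alpha> * real (card X)) - w * (\<Sum>t\<in>UNIV. real (card (?U (Y t))))"
    using mult_left_mono[OF pairs \<open>w \<ge> 0\<close>] by simp
  also have "\<dots> = (\<Sum>t\<in>UNIV. ?f t)"
    by (simp add: size sum_subtractf sum_distrib_left)
  \<comment> \<open>Otherwise \<open>?f\<close> would lie below the constant \<open>?v\<close>
    everywhere, and so would its sum.\<close>
  finally have "\<exists>t. ?v \<le> ?f t"
    by (metis (lifting) UNIV_I UNIV_not_empty finite not_le sum_strict_mono)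
  then show thesis
    using that unfolding \<alpha>_def by blast
qed

text \<open>Iterates \<open>exists_translate\<close> \<open>k\<close> times, starting from the whole
  group, where there are at most \<open>N\<^sup>2\<close> bad pairs for \<open>N = CARD('a)\<close>.
  The weight is arbitrary because it changes at every step.\<close>

lemma exists_few_unpopular_pairs:
  fixes A :: "'a::{ab_group_add,finite} set"
  assumes two: "\<And>x::'a. x + x = 0" and "c \<ge> 0" and "w \<ge> 0"
  shows "\<exists>X. set_density A ^ k *
      (real CARD('a) - w * (c * set_density A) ^ k * (real CARD('a))\<^sup>2)
      \<le> real (card X) - w * real (card (unpopular_pairs c A X))"
  using \<open>w \<ge> 0\<close>
proof (induction k arbitrary: w)
  case 0
  have "card (unpopular_pairs c A UNIV) \<le> card (UNIV :: ('a \<times> 'a) set)"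
    by (rule card_mono) auto
  also have "\<dots> = CARD('a)\<^sup>2"
    by (simp add: card_cartesian_product power2_eq_square flip: UNIV_Times_UNIV)
  finally have "real (card (unpopular_pairs c A UNIV)) \<le> (real CARD('a))\<^sup>2"
    by (metis of_nat_le_iff of_nat_power)
  then show ?case
    using 0 by (intro exI[of _ UNIV]) (simp add: mult_left_mono)
next
  case (Suc k)
  define \<alpha> where "\<alpha> = set_density A"
  have "\<alpha> \<ge> 0"
    by (simp add: \<alpha>_def set_density_def)
  with Suc.prems \<open>c \<ge> 0\<close> have "w * (c * \<alpha>) \<ge> 0"
    by simp
  \<comment> \<open>The weight \<open>w * (c * \<alpha>)\<close> is the one that the next translate
    turns into \<open>w\<close>.\<close>
  from Suc.IH[OF this] obtain X where X: "\<alpha> ^ k *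
      (real CARD('a) - w * (c * \<alpha>) * (c * \<alpha>) ^ k * (real CARD('a))\<^sup>2)
      \<le> real (card X) - w * (c * \<alpha>) * real (card (unpopular_pairs c A X))"
    unfolding \<alpha>_def by blast
  obtain Y where Y:
    "\<alpha> * (real (card X) - w * (c * \<alpha>) * real (card (unpopular_pairs c A X)))
      \<le> real (card Y) - w * real (card (unpopular_pairs c A Y))"
    using exists_translate[OF two Suc.prems] unfolding \<alpha>_def by blast
  show ?case
    using order_trans[OF mult_left_mono[OF X \<open>\<alpha> \<ge> 0\<close>] Y] unfolding \<alpha>_def[symmetric]
    by (intro exI[of _ Y]) (simp add: mult_ac)
qed

text \<open>Alteration step: \<open>small\<close> makes the term subtracted for bad pairs at most
  half of the main term, so removing one element per bad pair leaves enough.\<close>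

lemma exists_sumset_in_popular_diff:
  fixes A :: "'a::{ab_group_add,finite} set"
  assumes two: "\<And>x::'a. x + x = 0" and "c \<ge> 0"
    and small: "(c * set_density A) ^ k * real CARD('a) \<le> 1 / 2"
  shows "\<exists>B. B + B \<subseteq> popular_diff c A \<and> set_density A ^ k * real CARD('a) / 2 \<le> real (card B)"
proof -
  define \<alpha> where "\<alpha> = set_density A"
  define N where "N = real CARD('a)"
  have "\<alpha> \<ge> 0" "N \<ge> 0"
    by (simp_all add: \<alpha>_def set_density_def N_def)
  \<comment> \<open>Weight 1, since each bad pair costs at most one deleted element.\<close>
  obtain X where X: "\<alpha> ^ k * (N - (c * \<alpha>) ^ k * N\<^sup>2)
      \<le> real (card X) - real (card (unpopular_pairs c A X))"
    using exists_few_unpopular_pairs[OF two \<open>c \<ge> 0\<close>, of 1 A k] unfolding \<alpha>_def N_def by auto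
  have "(c * \<alpha>) ^ k * N\<^sup>2 \<le> N / 2"
    using mult_right_mono[OF small, of N] \<open>N \<ge> 0\<close>
    by (simp add: \<alpha>_def N_def power2_eq_square mult_ac)
  then have "\<alpha> ^ k * (N / 2) \<le> \<alpha> ^ k * (N - (c * \<alpha>) ^ k * N\<^sup>2)"
    using \<open>\<alpha> \<ge> 0\<close> by (intro mult_left_mono) auto
  \<comment> \<open>Deleting first entries suffices: every bad pair, including one with equal
    entries, loses its first entry.\<close>
  define B where "B = X - fst ` unpopular_pairs c A X"
  have "card X \<le> card B + card (fst ` unpopular_pairs c A X)"
    unfolding B_def using diff_card_le_card_Diff[of "fst ` unpopular_pairs c A X" X] by simp
  also have "\<dots> \<le> card B + card (unpopular_pairs c A X)"
    by (simp add: card_image_le)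
  finally have "real (card X) - real (card (unpopular_pairs c A X)) \<le> real (card B)"
    by simp
  moreover have "B + B \<subseteq> popular_diff c A"
  proof (rule subsetI, erule set_plus_elim)
    fix x a b assume "x = a + b" "a \<in> B" "b \<in> B"
    then have "a \<in> X" "b \<in> X" "(a, b) \<notin> unpopular_pairs c A X"
      unfolding B_def by (auto simp: image_iff)
    then show "x \<in> popular_diff c A"
      using \<open>x = a + b\<close> by (simp add: unpopular_pairs_def)
  qed
  ultimately show ?thesis
    using X \<open>\<alpha> ^ k * (N / 2) \<le> _\<close> unfolding \<alpha>_def N_def
    by (intro exI[of _ B]) auto
qed

text \<open>Two opposing demands on \<open>k\<close>: large enough to make bad pairs rare, small
  enough to keep \<open>\<alpha> ^ k * N\<close> large.\<close>

lemma exists_exponent: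
  fixes \<alpha> c N :: real
  assumes "0 < \<alpha>" "\<alpha> \<le> 1" "0 < c" "c \<le> 1 / 2" "N \<ge> 1"
  obtains k :: nat where "(c * \<alpha>) ^ k * N \<le> 1 / 2"
    and "\<alpha>\<^sup>2 * N powr (1 - ln (1 / \<alpha>) / ln (1 / c)) \<le> \<alpha> ^ k * N"
proof -
  define a where "a = ln (1 / \<alpha>)"
  define l where "l = ln (1 / c)"
  \<comment> \<open>The real solution of \<open>(c * \<alpha>) powr u * N = 1\<close>. The extra 1
    in \<open>k\<close> gains a factor \<open>c * \<alpha>\<close>, which is at most 1/2; rounding
    up costs less than 1 more, whence the factor \<open>\<alpha>\<^sup>2\<close> in the
    conclusion.\<close>
  define u where "u = ln N / (l + a)"
  define k where "k = nat \<lceil>u + 1\<rceil>"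
  have "a \<ge> 0" "l > 0"
    using assms by (simp_all add: a_def l_def)
  have \<alpha>: "\<alpha> = exp (- a)" and c: "c = exp (- l)" and N: "N = exp (ln N)"
    using assms by (simp_all add: a_def l_def ln_div)
  have "ln N \<ge> 0"
    using assms by simp
  then have "u \<ge> 0"
    using \<open>a \<ge> 0\<close> \<open>l > 0\<close> by (simp add: u_def)
  then have k: "u + 1 \<le> real k" "real k \<le> u + 2"
    unfolding k_def by linarith+
  have "c * \<alpha> \<le> 1 / 2"
    using mult_mono[of c "1 / 2" \<alpha> 1] assms by simp
  have "(c * \<alpha>) ^ k * N = exp (ln N - real k * (l + a))"
    by (subst \<alpha>, subst c, subst N)
      (simp add: exp_of_nat_mult[symmetric] algebra_simps flip: exp_add)
  also have "\<dots> \<le> exp (ln N - (u + 1) * (l + a))"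
    using k \<open>a \<ge> 0\<close> \<open>l > 0\<close> by (simp add: mult_right_mono)
  also have "\<dots> = exp (- (l + a))"
    using \<open>a \<ge> 0\<close> \<open>l > 0\<close> by (simp add: u_def distrib_right)
  also have "\<dots> = c * \<alpha>"
    using \<alpha> c by (simp add: exp_diff exp_minus field_simps)
  finally have 1: "(c * \<alpha>) ^ k * N \<le> 1 / 2"
    using \<open>c * \<alpha> \<le> 1 / 2\<close> by simp
  \<comment> \<open>Here the exponent is weakened to the claimed one, by dropping \<open>a\<close>
    from the denominator.\<close>
  have "u \<le> ln N / l"
    unfolding u_def using \<open>a \<ge> 0\<close> \<open>l > 0\<close> \<open>ln N \<ge> 0\<close> by (intro divide_left_mono) auto
  then have "real k * a \<le> (ln N / l + 2) * a"
    using k \<open>a \<ge> 0\<close> by (intro mult_right_mono) auto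
  then have "exp (ln N - (ln N / l + 2) * a) \<le> exp (ln N - real k * a)"
    by simp
  also have "\<dots> = \<alpha> ^ k * N"
    by (subst \<alpha>, subst (2) N) (simp add: exp_of_nat_mult[symmetric] flip: exp_add)
  finally have "exp (ln N - (ln N / l + 2) * a) \<le> \<alpha> ^ k * N" .
  \<comment> \<open>Uses \<open>exp (- (ln N / l) * a) = N powr (- a / l)\<close>.\<close>
  moreover have "exp (ln N - (ln N / l + 2) * a) = \<alpha>\<^sup>2 * N powr (1 - a / l)"
    using assms
    by (subst \<alpha>) (simp add: powr_def power2_eq_square algebra_simps flip: exp_add)
  ultimately show thesis
    using that[OF 1] unfolding a_def l_def by simp
qed

lemma card_bit_vec: "CARD(bit ^ 'n::finite) = 2 ^ CARD('n)"
proof -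
  have "(UNIV :: bit set) = {0, 1}"
    by (auto intro: bit.exhaust)
  then have "CARD(bit) = card {0 :: bit, 1}"
    by (rule arg_cong)
  then show ?thesis
    by (simp add: numeral_2_eq_2)
qed

theorem theorem1p8:
  fixes A :: "(bit ^ 'n::finite) set" and c :: real
  assumes "set_density A > 0" and "0 < c" and "c \<le> 1 / 2"
  shows "\<exists>A' :: (bit ^ 'n) set.
    A' + A' \<subseteq> popular_diff c A \<and>
    int (card A') \<ge>
      \<lfloor>set_density A ^ 3 *
        2 powr (real CARD('n) * (1 - ln (1 / set_density A) / ln (1 / c))) / 12\<rfloor>"
proof -
  define \<alpha> where "\<alpha> = set_density A"
  define N where "N = real CARD(bit ^ 'n)"
  define \<theta> where "\<theta> = 1 - ln (1 / \<alpha>) / ln (1 / c)"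
  have "0 < \<alpha>" "\<alpha> \<le> 1"
    using assms set_density_le_1 by (simp_all add: \<alpha>_def)
  have N: "N = 2 powr real CARD('n)"
    unfolding N_def card_bit_vec by (simp add: powr_realpow)
  then have "N \<ge> 1"
    by (simp add: ge_one_powr_ge_zero)
  then obtain k where k: "(c * \<alpha>) ^ k * N \<le> 1 / 2" "\<alpha>\<^sup>2 * N powr \<theta> \<le> \<alpha> ^ k * N"
    using exists_exponent[OF \<open>0 < \<alpha>\<close> \<open>\<alpha> \<le> 1\<close> \<open>0 < c\<close> \<open>c \<le> 1 / 2\<close>] unfolding \<theta>_def by metis
  have two: "x + x = 0" for x :: "bit ^ 'n"
    by (simp add: vec_eq_iff)
  from exists_sumset_in_popular_diff[OF two] k(1) \<open>0 < c\<close>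
  obtain A' where A': "A' + A' \<subseteq> popular_diff c A" "\<alpha> ^ k * N / 2 \<le> real (card A')"
    unfolding \<alpha>_def N_def by (meson less_imp_le)
  \<comment> \<open>The construction gives the factor \<open>\<alpha>\<^sup>2 / 2\<close>, which is
    at least the claimed \<open>\<alpha> ^ 3 / 12\<close> because
    \<open>\<alpha> \<le> 1\<close>.\<close>
  have "\<alpha> ^ 3 * N powr \<theta> / 12 \<le> \<alpha>\<^sup>2 * N powr \<theta> / 2"
    using \<open>0 < \<alpha>\<close> \<open>\<alpha> \<le> 1\<close> by (intro frac_le mult_right_mono power_decreasing) auto
  also have "\<dots> \<le> real (card A')"
    using k(2) A'(2) by simp
  finally have "\<alpha> ^ 3 * 2 powr (real CARD('n) * \<theta>) / 12 \<le> real (card A')"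
    by (simp add: N powr_powr)
  then have "\<lfloor>\<alpha> ^ 3 * 2 powr (real CARD('n) * \<theta>) / 12\<rfloor> \<le> int (card A')"
    by linarith
  then show ?thesis
    using A'(1) unfolding \<alpha>_def \<theta>_def by blast
qed

end
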